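(* Let $a>0$ and let $\lambda_a$ be the uniform probability measure on $[-a,a]$. Then for every $r\in(0,1]$ and every log-subharmonic function $f$ on $\mathbb{R}$, $$\|f_r\|_{1/r^2,\lambda_a}\le\|f\|_{1,\lambda_a},$$ where $f_r(x)=f(rx)$.
   Context: On $\mathbb{R}$, a function $f:\mathbb{R}\to[0,\infty)$ is log-subharmonic if $\log f$ is subharmonic: upper semicontinuous with values in $[-\infty,\infty)$, locally integrable, not identically $-\infty$, and satisfying $\log f(x)\le\frac12(\log f(x+y)+\log f(x-y))$ for all $x,y\in\mathbb{R}$; equivalently, $f>0$ and $\log f$ is convex. For $0<p<\infty$, $\|f\|_{p,m}=(\int|f|^p\,dm)^{1/p}$. *)

theory Defs
  imports "HOL-Analysis.Analysis"
begin

text \<open>The logarithm on the half-line, extended by \<open>-\<infinity>\<close> at 0. It is only ever applied to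
  nonnegative arguments; its value at negative numbers is irrelevant.\<close>

definition elog :: "real \<Rightarrow> ereal" where
  "elog t = (if t > 0 then ereal (ln t) else -\<infinity>)"

definition upper_semicontinuous :: "('a::topological_space \<Rightarrow> ereal) \<Rightarrow> bool" where
  "upper_semicontinuous u \<longleftrightarrow> (\<forall>c. open {x. u x < c})"

definition locally_integrable :: "(real \<Rightarrow> ereal) \<Rightarrow> bool" where
  "locally_integrable u \<longleftrightarrow> u \<in> borel_measurable borel \<and>
     (\<forall>K. compact K \<longrightarrow> (\<integral>\<^sup>+x\<in>K. e2ennreal \<bar>u x\<bar> \<partial>lborel) < \<infinity>)"

text \<open>Since \<open>u < \<infinity>\<close>, the sum in the last condition never has the form \<open>\<infinity> - \<infinity>\<close>.\<close>

definition subharmonic :: "(real \<Rightarrow> ereal) \<Rightarrow> bool" where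
  "subharmonic u \<longleftrightarrow>
     (\<forall>x. u x < \<infinity>) \<and>
     upper_semicontinuous u \<and>
     locally_integrable u \<and>
     (\<exists>x. u x \<noteq> -\<infinity>) \<and>
     (\<forall>x y. u x \<le> ereal (1/2) * (u (x + y) + u (x - y)))"

definition log_subharmonic :: "(real \<Rightarrow> real) \<Rightarrow> bool" where
  "log_subharmonic f \<longleftrightarrow> (\<forall>x. 0 \<le> f x) \<and> subharmonic (\<lambda>x. elog (f x))"

text \<open>\<open>(\<integral>|f|\<^sup>p dM)\<^sup>1\<^sup>/\<^sup>p\<close> for \<open>0 < p < \<infinity>\<close>, as an extended nonnegative real: it is \<open>\<infinity>\<close>
  exactly when the integral diverges.\<close>

definition Lp_norm :: "real \<Rightarrow> 'a measure \<Rightarrow> ('a \<Rightarrow> real) \<Rightarrow> ennreal" where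
  "Lp_norm p M f =
     (let I = (\<integral>\<^sup>+x. ennreal (\<bar>f x\<bar> powr p) \<partial>M)
      in if I = \<infinity> then \<infinity> else ennreal (enn2real I powr (1 / p)))"

end

theory Submission
  imports Defs
begin

text \<open>The uniform measure on \<open>[-a, a]\<close> is the law of \<open>a \<cdot> \<Sum>\<^sub>k \<epsilon>\<^sub>k / 2\<^sup>k\<close> with independent
  fair signs \<open>\<epsilon>\<^sub>k\<close>. For one sign, replacing \<open>ln f\<close> by its chord reduces the inequality to
  \<open>cosh (s c) \<le> cosh c powr s\<^sup>2\<close> for \<open>s = 1 / r \<ge> 1\<close>, which holds because \<open>ln (cosh c) / c\<^sup>2\<close>
  decreases in \<open>c > 0\<close>. Since averages of translates of a log-convex function are log-convex,
  the inequality passes to finitely many independent signs one at a time, and then to the limit.\<close>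

section \<open>The hyperbolic cosine\<close>

lemma sinh_ge_self:
  fixes x :: real
  assumes "0 \<le> x"
  shows "x \<le> sinh x"
proof -
  have "sinh 0 - 0 \<le> sinh x - x"
  proof (rule DERIV_nonneg_imp_nondecreasing[OF assms])
    fix t :: real
    have "((\<lambda>x. sinh x - x) has_real_derivative cosh t - 1) (at t)"
      by (auto intro!: derivative_eq_intros)
    then show "\<exists>y. ((\<lambda>x. sinh x - x) has_real_derivative y) (at t) \<and> 0 \<le> y"
      using cosh_real_ge_1[of t] by (intro exI conjI) auto
  qed
  then show ?thesis by simp
qed

text \<open>The difference of the two sides vanishes at 0 and has derivative
  \<open>(sinh t * cosh t - t) / cosh t ^ 2\<close>, which is nonnegative because
  \<open>t \<le> sinh t\<close> and \<open>1 \<le> cosh t\<close>. This is the sign needed to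
  differentiate \<open>ln (cosh t) / t\<^sup>2\<close>.\<close>

lemma mult_tanh_le_ln_cosh:
  fixes x :: real
  assumes "0 \<le> x"
  shows "x * tanh x \<le> 2 * ln (cosh x)"
proof -
  let ?g = "\<lambda>x::real. 2 * ln (cosh x) - x * tanh x"
  have "?g 0 \<le> ?g x"
  proof (rule DERIV_nonneg_imp_nondecreasing[OF assms])
    fix t :: real
    assume t: "0 \<le> t"
    have c: "cosh t \<noteq> 0" using cosh_real_pos[of t] by simp
    have "(?g has_real_derivative 2 * tanh t - (tanh t + t * (1 - tanh t ^ 2))) (at t)"
      using c by (auto intro!: derivative_eq_intros simp flip: tanh_def)
    moreover have "t \<le> sinh t * cosh t"
      using mult_mono[OF sinh_ge_self[OF t] cosh_real_ge_1[of t]] t by simp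
    then have "0 \<le> (sinh t * cosh t - t) / cosh t ^ 2"
      by simp
    moreover have "1 - tanh t ^ 2 = 1 / cosh t ^ 2"
      using c hyperbolic_pythagoras[of t] by (simp add: tanh_def power_divide diff_divide_eq_iff)
    then have "2 * tanh t - (tanh t + t * (1 - tanh t ^ 2)) = tanh t - t / cosh t ^ 2"
      by simp
    then have "(sinh t * cosh t - t) / cosh t ^ 2
        = 2 * tanh t - (tanh t + t * (1 - tanh t ^ 2))"
      using c by (simp add: tanh_def diff_divide_distrib power2_eq_square)
    ultimately show "\<exists>y. (?g has_real_derivative y) (at t) \<and> 0 \<le> y"
      by metis
  qed
  then show ?thesis by simp
qed

lemma cosh_mult_le_powr:
  fixes s c :: real
  assumes "1 \<le> s"
  shows "cosh (s * c) \<le> cosh c powr s\<^sup>2"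
proof -
  have pos: "cosh (s * x) \<le> cosh x powr s\<^sup>2" if x: "0 < x" for x :: real
  proof -
    have "ln (cosh (s * x)) / (s * x)\<^sup>2 \<le> ln (cosh x) / x\<^sup>2"
    proof (rule DERIV_nonpos_imp_nonincreasing[where f = "\<lambda>t. ln (cosh t) / t\<^sup>2"])
      show "x \<le> s * x" using assms x by simp
      fix t assume "x \<le> t" "t \<le> s * x"
      with x have t: "0 < t" by simp
      have "((\<lambda>t. ln (cosh t) / t\<^sup>2) has_real_derivative
          (tanh t * t\<^sup>2 - ln (cosh t) * (2 * t)) / (t\<^sup>2 * t\<^sup>2)) (at t)"
        using t cosh_real_pos[of t]
        by (auto intro!: derivative_eq_intros simp: tanh_def)
      \<comment> \<open>The numerator is a positive multiple of the quantity whose sign is settled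
        by \<open>mult_tanh_le_ln_cosh\<close>.\<close>
      moreover have "tanh t * t\<^sup>2 - ln (cosh t) * (2 * t) = t * (t * tanh t - 2 * ln (cosh t))"
        by (simp add: power2_eq_square algebra_simps)
      then have "(tanh t * t\<^sup>2 - ln (cosh t) * (2 * t)) / (t\<^sup>2 * t\<^sup>2) \<le> 0"
        using t mult_tanh_le_ln_cosh[of t]
        by (simp add: divide_le_0_iff mult_le_0_iff)
      ultimately show "\<exists>y. ((\<lambda>t. ln (cosh t) / t\<^sup>2) has_real_derivative y) (at t) \<and> y \<le> 0"
        by blast
    qed
    then have "ln (cosh (s * x)) \<le> s\<^sup>2 * ln (cosh x)"
      using x assms by (simp add: divide_simps power_mult_distrib mult.commute)
    then have "exp (ln (cosh (s * x))) \<le> exp (s\<^sup>2 * ln (cosh x))"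
      by (simp only: exp_le_cancel_iff)
    then show ?thesis
      using cosh_real_pos[of x] cosh_real_pos[of "s * x"] by (simp add: powr_def)
  qed
  \<comment> \<open>The quotient is only meaningful away from 0; negative \<open>c\<close> reduces
    to positive \<open>c\<close> because \<open>cosh\<close> is even.\<close>
  consider "c = 0" | "0 < c" | "0 < - c" by linarith
  then show ?thesis
    using pos[of c] pos[of "- c"] by cases auto
qed

section \<open>Log-convex functions\<close>

text \<open>Positivity is a separate conjunct because \<open>ln\<close> is total, so convexity of
  \<open>ln (f x)\<close> says nothing useful where \<open>f\<close> is not positive.\<close>

definition log_convex :: "(real \<Rightarrow> real) \<Rightarrow> bool" where
  "log_convex f \<longleftrightarrow> (\<forall>x. 0 < f x) \<and> convex_on UNIV (\<lambda>x. ln (f x))"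

lemma log_convex_pos: "log_convex f \<Longrightarrow> 0 < f x"
  by (simp add: log_convex_def)

text \<open>Exponentiating the convexity inequality gives this multiplicative form, to which
  Hoelder's inequality applies directly when functions are added.\<close>

lemma log_convex_iff:
  "log_convex f \<longleftrightarrow> (\<forall>x. 0 < f x) \<and>
     (\<forall>x y t. 0 < t \<longrightarrow> t < 1 \<longrightarrow> f ((1 - t) * x + t * y) \<le> f x powr (1 - t) * f y powr t)"
proof -
  have "ln (f ((1 - t) * x + t * y)) \<le> (1 - t) * ln (f x) + t * ln (f y) \<longleftrightarrow>
      f ((1 - t) * x + t * y) \<le> f x powr (1 - t) * f y powr t"
    if pos: "\<And>z. 0 < f z" for x y t
  proof -
    have "(1 - t) * ln (f x) + t * ln (f y) = ln (f x powr (1 - t) * f y powr t)"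
      using pos[of x] pos[of y] by (simp add: ln_mult)
    then show ?thesis
      using pos[of x] pos[of y] pos[of "(1 - t) * x + t * y"] by simp
  qed
  moreover have "convex_on UNIV g \<longleftrightarrow>
      (\<forall>x y t. 0 < t \<longrightarrow> t < 1 \<longrightarrow> g ((1 - t) * x + t * y) \<le> (1 - t) * g x + t * g y)"
    for g :: "real \<Rightarrow> real"
  proof
    show "\<forall>x y t. 0 < t \<longrightarrow> t < 1 \<longrightarrow> g ((1 - t) * x + t * y) \<le> (1 - t) * g x + t * g y"
      if "convex_on UNIV g"
      using convex_onD[OF that] by simp
    show "convex_on UNIV g"
      if "\<forall>x y t. 0 < t \<longrightarrow> t < 1 \<longrightarrow> g ((1 - t) * x + t * y) \<le> (1 - t) * g x + t * g y"
      using that by (intro convex_onI) auto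
  qed
  ultimately show ?thesis
    unfolding log_convex_def by meson
qed

lemma log_convex_continuous:
  assumes "log_convex f"
  shows "continuous_on UNIV f"
proof -
  have "continuous_on UNIV (\<lambda>x. exp (ln (f x)))"
    using assms by (intro continuous_on_exp convex_on_continuous) (auto simp: log_convex_def)
  then show ?thesis
    using assms by (simp add: log_convex_def)
qed

lemma log_convex_shift:
  assumes "log_convex f"
  shows "log_convex (\<lambda>x. f (x + c))"
proof -
  have "f ((1 - t) * x + t * y + c) \<le> f (x + c) powr (1 - t) * f (y + c) powr t"
    if "0 < t" "t < 1" for x y t
  proof -
    have "(1 - t) * x + t * y + c = (1 - t) * (x + c) + t * (y + c)"
      by (simp add: algebra_simps)
    then show ?thesis
      using assms that by (simp add: log_convex_iff)
  qed
  then show ?thesis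
    using assms by (simp add: log_convex_iff)
qed

text \<open>Normalise by the totals \<open>X = A + C\<close> and \<open>Y = B + D\<close>, apply
  weighted AM-GM to each pair of ratios and add: the right-hand sides sum to
  \<open>(1 - t) + t = 1\<close>.\<close>

lemma Hoelder_two_terms:
  fixes A B C D t :: real
  assumes "0 < A" "0 < B" "0 < C" "0 < D" and t: "0 \<le> t" "t \<le> 1"
  shows "A powr (1 - t) * B powr t + C powr (1 - t) * D powr t
    \<le> (A + C) powr (1 - t) * (B + D) powr t"
proof -
  define X Y where "X = A + C" and "Y = B + D"
  have pos: "0 < X" "0 < Y" using assms by (simp_all add: X_def Y_def)
  let ?Z = "X powr (1 - t) * Y powr t"
  have *: "U powr (1 - t) * V powr t \<le> ?Z * ((1 - t) * (U / X) + t * (V / Y))"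
    if "0 < U" "0 < V" for U V
  proof -
    have "(U / X) powr (1 - t) * (V / Y) powr t \<le> (1 - t) * (U / X) + t * (V / Y)"
      using that pos t Youngs_inequality_0[of "1 - t" t "U / X" "V / Y"] by simp
    then have "?Z * ((U / X) powr (1 - t) * (V / Y) powr t)
        \<le> ?Z * ((1 - t) * (U / X) + t * (V / Y))"
      using pos by (intro mult_left_mono) simp_all
    then show ?thesis
      using that pos by (simp add: powr_divide)
  qed
  have "A powr (1 - t) * B powr t + C powr (1 - t) * D powr t
      \<le> ?Z * ((1 - t) * ((A + C) / X) + t * ((B + D) / Y))"
    using *[of A B] *[of C D] assms by (simp add: add_divide_distrib distrib_left)
  also have "\<dots> = ?Z"
    using pos by (simp flip: X_def Y_def)
  finally show ?thesis by (simp add: X_def Y_def)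
qed

lemma log_convex_add:
  assumes "log_convex f" "log_convex g"
  shows "log_convex (\<lambda>x. f x + g x)"
  unfolding log_convex_iff
proof (intro conjI allI impI)
  show "0 < f x + g x" for x
    using assms by (simp add: log_convex_pos add_pos_pos)
  fix x y t :: real
  assume t: "0 < t" "t < 1"
  have "f ((1 - t) * x + t * y) + g ((1 - t) * x + t * y)
      \<le> f x powr (1 - t) * f y powr t + g x powr (1 - t) * g y powr t"
    using assms t by (intro add_mono) (auto simp: log_convex_iff)
  also have "\<dots> \<le> (f x + g x) powr (1 - t) * (f y + g y) powr t"
    using assms t by (intro Hoelder_two_terms) (auto simp: log_convex_pos)
  finally show "f ((1 - t) * x + t * y) + g ((1 - t) * x + t * y)
      \<le> (f x + g x) powr (1 - t) * (f y + g y) powr t" .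
qed

lemma log_convex_divide:
  assumes "log_convex f" "0 < c"
  shows "log_convex (\<lambda>x. f x / c)"
proof -
  have "convex_on UNIV (\<lambda>x. ln (f x) + (- ln c))"
    using assms by (intro convex_on_add) (auto simp: log_convex_def convex_on_const)
  moreover have "ln (f x / c) = ln (f x) + (- ln c)" for x
    using assms log_convex_pos[of f x] by (simp add: ln_div)
  ultimately show ?thesis
    using assms by (simp add: log_convex_def)
qed

text \<open>The chord of \<open>ln f\<close> between \<open>- d\<close> and \<open>d\<close> takes
  the values \<open>m - c\<close> and \<open>m + c\<close> at the ends, hence bounds
  \<open>ln f\<close> by \<open>m - r * c\<close> and \<open>m + r * c\<close> at
  \<open>- (r * d)\<close> and \<open>r * d\<close>. With \<open>p = 1 / r\<^sup>2\<close> one has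
  \<open>p * r = 1 / r\<close>, so after factoring out \<open>exp (p * m)\<close> the claim is
  \<open>cosh (c / r) \<le> cosh c powr p\<close>.\<close>

lemma log_convex_two_point:
  assumes f: "log_convex f" and r: "0 < r" "r \<le> 1"
  shows "(f (r * d) powr (1 / r\<^sup>2) + f (- (r * d)) powr (1 / r\<^sup>2)) / 2
    \<le> ((f d + f (- d)) / 2) powr (1 / r\<^sup>2)"
proof -
  define p where "p = 1 / r\<^sup>2"
  define u where "u = (\<lambda>x. ln (f x))"
  define m where "m = (u d + u (- d)) / 2"
  define c where "c = (u d - u (- d)) / 2"
  have f_eq: "f x = exp (u x)" for x
    using log_convex_pos[OF f, of x] by (simp add: u_def)
  have conv: "u ((1 - t) * x + t * y) \<le> (1 - t) * u x + t * u y" if "0 \<le> t" "t \<le> 1" for t x y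
    using f that convex_onD[of UNIV u t x y] by (simp add: log_convex_def u_def)
  have p: "p * r = 1 / r" "0 < p"
    using r by (simp_all add: p_def power2_eq_square)
  \<comment> \<open>The weight \<open>(1 + r) / 2\<close> is the relative position of
    \<open>r * d\<close> on the way from \<open>- d\<close> to \<open>d\<close>.\<close>
  have "r * d = (1 - (1 + r) / 2) * (- d) + (1 + r) / 2 * d"
    by (simp add: field_simps)
  then have "u (r * d) \<le> (1 - (1 + r) / 2) * u (- d) + (1 + r) / 2 * u d"
    using conv[of "(1 + r) / 2" "- d" d] r by simp
  also have "\<dots> = m + r * c" by (simp add: m_def c_def field_simps)
  finally have up: "u (r * d) \<le> m + r * c" .
  have "- (r * d) = (1 - (1 + r) / 2) * d + (1 + r) / 2 * (- d)"
    by (simp add: field_simps)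
  then have "u (- (r * d)) \<le> (1 - (1 + r) / 2) * u d + (1 + r) / 2 * u (- d)"
    using conv[of "(1 + r) / 2" d "- d"] r by simp
  also have "\<dots> = m - r * c" by (simp add: m_def c_def field_simps)
  finally have um: "u (- (r * d)) \<le> m - r * c" .
  have "f (r * d) powr p \<le> exp (p * m + c / r)"
    using mult_left_mono[OF up, of p] p by (simp add: f_eq powr_def field_simps)
  moreover have "f (- (r * d)) powr p \<le> exp (p * m - c / r)"
    using mult_left_mono[OF um, of p] p by (simp add: f_eq powr_def field_simps)
  ultimately have "(f (r * d) powr p + f (- (r * d)) powr p) / 2
      \<le> (exp (p * m + c / r) + exp (p * m - c / r)) / 2"
    by simp
  also have "\<dots> = exp (p * m) * cosh (1 / r * c)"
    by (simp add: cosh_def exp_add exp_diff exp_minus field_simps)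
  also have "\<dots> \<le> exp (p * m) * cosh c powr p"
    using cosh_mult_le_powr[of "1 / r" c] r by (simp add: p_def power_divide)
  also have "\<dots> = (exp m * cosh c) powr p"
    by (simp add: powr_mult exp_powr_real mult.commute)
  also have "exp m * cosh c = (exp (m + c) + exp (m - c)) / 2"
    by (simp add: cosh_def exp_add exp_diff exp_minus field_simps)
  also have "\<dots> = (f d + f (- d)) / 2"
  proof -
    have "m + c = u d" "m - c = u (- d)" by (simp_all add: m_def c_def field_simps)
    then show ?thesis by (simp add: f_eq)
  qed
  finally show ?thesis by (simp add: p_def)
qed

section \<open>Dyadic averages\<close>

text \<open>The expectation of \<open>g\<close> at \<open>a \<cdot> (\<epsilon>\<^sub>1 / 2 + \<dots> + \<epsilon>\<^sub>n / 2\<^sup>n)\<close> for independent uniform signs.\<close>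

primrec dyadic_mean :: "nat \<Rightarrow> real \<Rightarrow> (real \<Rightarrow> real) \<Rightarrow> real" where
  "dyadic_mean 0 a g = g 0"
| "dyadic_mean (Suc n) a g =
     (dyadic_mean n (a / 2) (\<lambda>x. g (x + a / 2)) + dyadic_mean n (a / 2) (\<lambda>x. g (x - a / 2))) / 2"

text \<open>Each level averages two translates, and log-convexity survives translation, addition and
  division by 2.\<close>

lemma log_convex_dyadic_mean:
  assumes "log_convex f"
  shows "log_convex (\<lambda>y. dyadic_mean n a (\<lambda>x. f (x + y)))"
  using assms
proof (induction n arbitrary: a f)
  case (Suc n)
  have "log_convex (\<lambda>y. dyadic_mean n (a / 2) (\<lambda>x. f (x + y + c)))" for c
    using Suc.IH[OF log_convex_shift[OF Suc.prems]] .
  from log_convex_divide[OF log_convex_add[OF this[of "a / 2"] this[of "- (a / 2)"]], of 2]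
  show ?case
    by (simp add: algebra_simps)
qed simp

text \<open>The induction step is the tensorisation of the two-point inequality: conditionally on the
  first sign, the average over the others is again log-convex in the shift.\<close>

lemma dyadic_mean_contraction:
  assumes "log_convex f" "0 < r" "r \<le> 1"
  shows "dyadic_mean n a (\<lambda>x. f (r * x) powr (1 / r\<^sup>2)) \<le> dyadic_mean n a f powr (1 / r\<^sup>2)"
  using assms(1)
proof (induction n arbitrary: a f)
  case (Suc n)
  define G where "G = (\<lambda>y. dyadic_mean n (a / 2) (\<lambda>x. f (x + y)))"
  have "dyadic_mean n (a / 2) (\<lambda>x. f (r * x + y) powr (1 / r\<^sup>2)) \<le> G y powr (1 / r\<^sup>2)" for y
    using Suc.IH[OF log_convex_shift[OF Suc.prems]] by (simp add: G_def)
  \<comment> \<open>The first sign moves the argument of \<open>f\<close> by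
    \<open>r * (a / 2)\<close> in either direction, since the dilation acts on the whole signed
    sum.\<close>
  from this[of "r * (a / 2)"] this[of "- (r * (a / 2))"]
  have "dyadic_mean (Suc n) a (\<lambda>x. f (r * x) powr (1 / r\<^sup>2))
      \<le> (G (r * (a / 2)) powr (1 / r\<^sup>2) + G (- (r * (a / 2))) powr (1 / r\<^sup>2)) / 2"
    by (simp add: algebra_simps)
  also have "\<dots> \<le> ((G (a / 2) + G (- (a / 2))) / 2) powr (1 / r\<^sup>2)"
    unfolding G_def by (intro log_convex_two_point log_convex_dyadic_mean Suc.prems assms)
  finally show ?case
    by (simp add: G_def)
qed simp

section \<open>Convergence of the dyadic averages to the integral mean\<close>

lemma integral_mean_halves:
  fixes g :: "real \<Rightarrow> real"
  assumes "continuous_on UNIV g" "0 < a"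
  shows "integral {- a..a} g =
    integral {- (a / 2)..a / 2} (\<lambda>x. g (x + a / 2)) + integral {- (a / 2)..a / 2} (\<lambda>x. g (x - a / 2))"
proof -
  have "integral {- a..a} g = integral {- a..0} g + integral {0..a} g"
    using assms
    by (intro Henstock_Kurzweil_Integration.integral_combine[symmetric]
        integrable_continuous_real continuous_on_subset[OF assms(1)]) auto
  also have "integral {0..a} g = integral {- (a / 2)..a / 2} (\<lambda>x. g (x + a / 2))"
    using integral_shift_real_ivl[of 0 "a / 2" a g] by simp
  also have "integral {- a..0} g = integral {- (a / 2)..a / 2} (\<lambda>x. g (x - a / 2))"
    using integral_shift_real_ivl[of "- a" "- (a / 2)" 0 g] by simp
  finally show ?thesis by simp
qed

text \<open>The \<open>2 ^ n\<close> sample points are the centres of intervals of radius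
  \<open>a / 2 ^ n\<close> tiling \<open>{- a..a}\<close>, so this is a Riemann sum with error at
  most the oscillation \<open>e\<close> at that scale. In the induction \<open>a\<close> is halved
  as \<open>n\<close> drops by one, which keeps \<open>a / 2 ^ n\<close> and hence the oscillation
  hypothesis intact on both halves.\<close>

lemma dyadic_mean_approx:
  assumes "continuous_on UNIV g" "0 < a"
    and "\<And>x y. \<lbrakk>\<bar>x\<bar> \<le> a; \<bar>y\<bar> \<le> a; \<bar>x - y\<bar> \<le> a / 2 ^ n\<rbrakk> \<Longrightarrow> \<bar>g x - g y\<bar> \<le> e"
  shows "\<bar>dyadic_mean n a g - integral {- a..a} g / (2 * a)\<bar> \<le> e"
  using assms
proof (induction n arbitrary: a g)
  case 0
  have int: "g integrable_on {- a..a}"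
    using 0 by (intro integrable_continuous_real continuous_on_subset[OF 0(1)]) auto
  have bound: "g 0 - e \<le> g x \<and> g x \<le> g 0 + e" if "x \<in> {- a..a}" for x
    using 0(2) 0(3)[of x 0] that by (auto simp: abs_le_iff)
  have "integral {- a..a} (\<lambda>x. g 0 - e) \<le> integral {- a..a} g"
    using bound by (intro integral_le int) auto
  moreover have "integral {- a..a} g \<le> integral {- a..a} (\<lambda>x. g 0 + e)"
    using bound by (intro integral_le int) auto
  ultimately show ?case
    using 0(2) by (simp add: abs_le_iff field_simps)
next
  case (Suc n)
  have *: "\<bar>dyadic_mean n (a / 2) (\<lambda>x. g (x + c)) - integral {- (a / 2)..a / 2} (\<lambda>x. g (x + c)) / a\<bar> \<le> e"
    if "\<bar>c\<bar> = a / 2" for c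
  proof -
    have "\<bar>dyadic_mean n (a / 2) (\<lambda>x. g (x + c))
        - integral {- (a / 2)..a / 2} (\<lambda>x. g (x + c)) / (2 * (a / 2))\<bar> \<le> e"
    proof (rule Suc.IH)
      show "continuous_on UNIV (\<lambda>x. g (x + c))"
        by (intro continuous_on_compose2[OF Suc.prems(1)] continuous_intros) auto
      show "0 < a / 2" using Suc.prems by simp
      fix x y assume "\<bar>x\<bar> \<le> a / 2" "\<bar>y\<bar> \<le> a / 2" "\<bar>x - y\<bar> \<le> a / 2 / 2 ^ n"
      then show "\<bar>g (x + c) - g (y + c)\<bar> \<le> e"
        using that by (intro Suc.prems(3)) auto
    qed
    then show ?thesis by simp
  qed
  have "dyadic_mean (Suc n) a g - integral {- a..a} g / (2 * a) =
      ((dyadic_mean n (a / 2) (\<lambda>x. g (x + a / 2)) - integral {- (a / 2)..a / 2} (\<lambda>x. g (x + a / 2)) / a)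
      + (dyadic_mean n (a / 2) (\<lambda>x. g (x - a / 2)) - integral {- (a / 2)..a / 2} (\<lambda>x. g (x - a / 2)) / a)) / 2"
    using Suc.prems(2) integral_mean_halves[OF Suc.prems(1,2)] by (simp add: field_simps)
  also have "\<bar>\<dots>\<bar> \<le> e"
    using *[of "a / 2"] *[of "- (a / 2)"] Suc.prems(2) by (auto simp: abs_le_iff)
  finally show ?case .
qed

lemma dyadic_mean_tendsto:
  assumes g: "continuous_on UNIV g" and a: "0 < a"
  shows "(\<lambda>n. dyadic_mean n a g) \<longlonglongrightarrow> integral {- a..a} g / (2 * a)"
proof (rule LIMSEQ_I)
  fix e :: real
  assume e: "0 < e"
  have "uniformly_continuous_on {- a..a} g"
    by (intro compact_uniformly_continuous continuous_on_subset[OF g]) auto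
  then obtain d where d: "0 < d"
    and gd: "\<And>x y. \<lbrakk>x \<in> {- a..a}; y \<in> {- a..a}; dist y x < d\<rbrakk> \<Longrightarrow> dist (g y) (g x) < e / 2"
    using e unfolding uniformly_continuous_on_def by (metis half_gt_zero)
  have "(\<lambda>n. a / 2 ^ n) \<longlonglongrightarrow> 0"
    using LIMSEQ_divide_realpow_zero[of 2 a] by simp
  then obtain N where N: "\<And>n. N \<le> n \<Longrightarrow> a / 2 ^ n < d"
    using d a LIMSEQ_D[of "\<lambda>n. a / 2 ^ n" 0 d] by auto
  have "norm (dyadic_mean n a g - integral {- a..a} g / (2 * a)) < e" if "N \<le> n" for n
  proof -
    \<comment> \<open>Half of \<open>e\<close> is used because the approximation bound is not
      strict.\<close>
    have "\<bar>dyadic_mean n a g - integral {- a..a} g / (2 * a)\<bar> \<le> e / 2"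
    proof (rule dyadic_mean_approx[OF g a])
      fix x y assume "\<bar>x\<bar> \<le> a" "\<bar>y\<bar> \<le> a" "\<bar>x - y\<bar> \<le> a / 2 ^ n"
      then have "dist (g x) (g y) < e / 2"
        using N[OF that] by (intro gd) (auto simp: dist_real_def abs_le_iff)
      then show "\<bar>g x - g y\<bar> \<le> e / 2"
        by (simp add: dist_real_def)
    qed
    with e show ?thesis by simp
  qed
  then show "\<exists>N. \<forall>n\<ge>N. norm (dyadic_mean n a g - integral {- a..a} g / (2 * a)) < e"
    by blast
qed

lemma integral_mean_contraction:
  assumes "log_convex f" "0 < r" "r \<le> 1" "0 < a"
  shows "integral {- a..a} (\<lambda>x. f (r * x) powr (1 / r\<^sup>2)) / (2 * a)
    \<le> (integral {- a..a} f / (2 * a)) powr (1 / r\<^sup>2)"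
proof (rule LIMSEQ_le)
  have f: "continuous_on UNIV f"
    by (rule log_convex_continuous) fact
  have "continuous_on UNIV (\<lambda>x. f (r * x))"
    by (intro continuous_on_compose2[OF f] continuous_intros) auto
  then have "continuous_on UNIV (\<lambda>x. f (r * x) powr (1 / r\<^sup>2))"
    using log_convex_pos[OF assms(1)] by (intro continuous_on_powr continuous_intros) (auto simp: less_imp_neq[symmetric])
  then show "(\<lambda>n. dyadic_mean n a (\<lambda>x. f (r * x) powr (1 / r\<^sup>2)))
      \<longlonglongrightarrow> integral {- a..a} (\<lambda>x. f (r * x) powr (1 / r\<^sup>2)) / (2 * a)"
    using \<open>0 < a\<close> by (rule dyadic_mean_tendsto)
  have "0 < dyadic_mean n a f" for n
    using log_convex_pos[OF log_convex_dyadic_mean[OF assms(1), of n a], of 0] by simp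
  then show "(\<lambda>n. dyadic_mean n a f powr (1 / r\<^sup>2))
      \<longlonglongrightarrow> (integral {- a..a} f / (2 * a)) powr (1 / r\<^sup>2)"
    using dyadic_mean_tendsto[OF f \<open>0 < a\<close>] assms
    by (intro tendsto_powr2 tendsto_const) (auto intro!: always_eventually less_imp_le)
  show "\<exists>N. \<forall>n\<ge>N. dyadic_mean n a (\<lambda>x. f (r * x) powr (1 / r\<^sup>2)) \<le> dyadic_mean n a f powr (1 / r\<^sup>2)"
    using dyadic_mean_contraction assms by blast
qed

section \<open>Log-subharmonic functions on the line are log-convex\<close>

text \<open>Without a maximum, the open sets \<open>{x. w x < w z}\<close> with \<open>z\<close> in
  \<open>S\<close> would cover \<open>S\<close>. In a finite subcover, the index \<open>z\<close>
  with the largest \<open>w z\<close> is itself a point of \<open>S\<close> that no set of the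
  subcover contains.\<close>

lemma usc_attains_sup:
  fixes w :: "real \<Rightarrow> real"
  assumes "compact S" "S \<noteq> {}" and usc: "\<And>c. open {x. w x < c}"
  shows "\<exists>z\<in>S. \<forall>x\<in>S. w x \<le> w z"
proof (rule ccontr)
  assume "\<not> ?thesis"
  then have "S \<subseteq> (\<Union>z\<in>S. {x. w x < w z})"
    by (force simp: not_le)
  then obtain T where T: "T \<subseteq> S" "finite T" "S \<subseteq> (\<Union>z\<in>T. {x. w x < w z})"
    using compactE_image[OF \<open>compact S\<close>, of S "\<lambda>z. {x. w x < w z}"] usc by metis
  have "T \<noteq> {}" using T(3) \<open>S \<noteq> {}\<close> by auto
  then obtain z where z: "z \<in> T" "\<And>y. y \<in> T \<Longrightarrow> w y \<le> w z"
    using Max_in[of "w ` T"] Max_ge[of "w ` T"] T(2) by (metis (no_types, lifting) finite_imageI image_iff image_is_empty)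
  obtain y where "y \<in> T" "w z < w y" using T(1,3) z(1) by blast
  then show False using z(2) by fastforce
qed

text \<open>Subtracting the chord keeps both hypotheses and makes the difference \<open>w\<close>
  vanish at the endpoints. Upper semicontinuity gives a maximum of \<open>w\<close> on the interval,
  and the midpoint inequality pushes it to an endpoint, so \<open>w\<close> is nonpositive
  throughout.\<close>

lemma midpoint_convex_usc_imp_convex:
  fixes u :: "real \<Rightarrow> real"
  assumes usc: "\<And>c. open {x. u x < c}"
    and mid: "\<And>x y. 2 * u x \<le> u (x + y) + u (x - y)"
  shows "convex_on UNIV u"
proof (rule convex_on_linorderI)
  fix t x y :: real
  assume t: "0 < t" "t < 1" and xy: "x < y"
  define k where "k = (u y - u x) / (y - x)"
  define w where "w = (\<lambda>z. u z - (u x + k * (z - x)))"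
  have k: "k * (y - x) = u y - u x" using xy by (simp add: k_def)
  have wx: "w x = 0" and wy: "w y = 0" using k by (simp_all add: w_def)
  have wmid: "2 * w z \<le> w (z + h) + w (z - h)" for z h
    using mid[of z h] by (simp add: w_def algebra_simps)
  have wusc: "open {z. w z < c}" for c
  proof -
    let ?l = "\<lambda>z. u x + k * (z - x)"
    \<comment> \<open>Inserting a level \<open>q\<close> between \<open>u z\<close> and the affine
      function separates the two, so the sublevel set becomes a union of intersections of open
      sets.\<close>
    have "w z < c \<longleftrightarrow> (\<exists>q. u z < q \<and> q < ?l z + c)" for z
      using dense[of "u z" "?l z + c"] by (auto simp: w_def)
    then have "{z. w z < c} = (\<Union>q. {z. u z < q} \<inter> {z. q < ?l z + c})"
      by blast
    moreover have "open {z. q < ?l z + c}" for q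
      by (intro open_Collect_less continuous_intros)
    ultimately show ?thesis by (simp only:) (intro open_UN ballI open_Int usc)
  qed
  obtain z0 where z0: "z0 \<in> {x..y}" "\<And>z. z \<in> {x..y} \<Longrightarrow> w z \<le> w z0"
    using usc_attains_sup[of "{x..y}" w] wusc xy by auto
  define K where "K = {z \<in> {x..y}. w z0 \<le> w z}"
  have "K = {x..y} - {z. w z < w z0}" by (auto simp: K_def)
  then have "closed K" using wusc by (simp add: closed_Diff)
  moreover have bdd: "bdd_below K" by (auto simp: K_def)
  moreover have "z0 \<in> K" using z0 by (simp add: K_def)
  ultimately have inf: "Inf K \<in> K" by (intro closed_contains_Inf) auto
  text \<open>At the leftmost maximiser the midpoint inequality can only hold at the boundary.\<close>
  have "Inf K = x \<or> Inf K = y"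
  proof (rule ccontr)
    assume "\<not> ?thesis"
    then have "x < Inf K" "Inf K < y" using inf by (auto simp: K_def)
    \<comment> \<open>This is the largest step for which both \<open>Inf K + h\<close> and
      \<open>Inf K - h\<close> stay in the interval.\<close>
    define h where "h = min (Inf K - x) (y - Inf K)"
    have h: "0 < h" "Inf K + h \<in> {x..y}" "Inf K - h \<in> {x..y}"
      using \<open>x < Inf K\<close> \<open>Inf K < y\<close> by (auto simp: h_def)
    have "w z0 \<le> w (Inf K - h)"
      using wmid[of "Inf K" h] z0(2)[OF h(2)] inf by (simp add: K_def)
    then have "Inf K - h \<in> K" using h by (simp add: K_def)
    then show False using cInf_lower[OF _ bdd] h(1) by fastforce
  qed
  then have "w z0 \<le> 0" using inf wx wy by (auto simp: K_def)
  moreover have "(1 - t) * x + t * y \<in> {x..y}"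
    using convex_real_interval(5)[of x y] xy t by (auto simp: convex_alt)
  ultimately have "w ((1 - t) * x + t * y) \<le> 0" using z0(2) by fastforce
  moreover have "k * ((1 - t) * x + t * y - x) = t * (u y - u x)"
    by (simp add: algebra_simps flip: k)
  ultimately show "u ((1 - t) *\<^sub>R x + t *\<^sub>R y) \<le> (1 - t) * u x + t * u y"
    by (simp add: w_def algebra_simps)
qed auto

lemma log_subharmonic_imp_log_convex:
  assumes "log_subharmonic f"
  shows "log_convex f"
proof -
  let ?u = "\<lambda>x. elog (f x)"
  have nonneg: "0 \<le> f x" for x
    using assms by (simp add: log_subharmonic_def)
  have usc: "open {x. ?u x < c}" for c
    using assms by (simp add: log_subharmonic_def subharmonic_def upper_semicontinuous_def)
  have mid: "?u x \<le> ereal (1/2) * (?u (x + y) + ?u (x - y))" for x y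
    using assms unfolding log_subharmonic_def subharmonic_def by blast
  obtain x1 where x1: "?u x1 \<noteq> - \<infinity>"
    using assms unfolding log_subharmonic_def subharmonic_def by blast
  text \<open>A zero of \<open>f\<close> at \<open>x\<close> would force a zero at \<open>x1\<close>, the midpoint of \<open>x\<close> and \<open>2 * x1 - x\<close>.\<close>
  have pos: "0 < f x" for x
  proof (rule ccontr)
    assume "\<not> 0 < f x"
    then have "?u (x1 - (x1 - x)) = - \<infinity>" by (simp add: elog_def)
    \<comment> \<open>In \<open>ereal\<close> the sum of \<open>\<infinity>\<close> and
      \<open>-\<infinity>\<close> is \<open>\<infinity>\<close>, so this value must be excluded
      before the right-hand side can be evaluated as \<open>-\<infinity>\<close>.\<close>
    moreover have "?u (x1 + (x1 - x)) \<noteq> \<infinity>" by (simp add: elog_def)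
    ultimately have "?u x1 \<le> - \<infinity>"
      using mid[of x1 "x1 - x"] by (cases "?u (x1 + (x1 - x))") simp_all
    with x1 show False by simp
  qed
  have "convex_on UNIV (\<lambda>x. ln (f x))"
  proof (rule midpoint_convex_usc_imp_convex)
    show "open {x. ln (f x) < c}" for c
      using usc[of "ereal c"] pos by (simp add: elog_def)
    show "2 * ln (f x) \<le> ln (f (x + y)) + ln (f (x - y))" for x y
      using mid[of x y] pos by (simp add: elog_def)
  qed
  with pos show ?thesis by (simp add: log_convex_def)
qed

section \<open>Integrals and norms for the uniform measure\<close>

lemma nn_integral_uniform_Icc:
  fixes g :: "real \<Rightarrow> real"
  assumes g: "continuous_on UNIV g" "\<And>x. 0 \<le> g x" and a: "0 < a"
  shows "(\<integral>\<^sup>+x. ennreal (g x) \<partial>uniform_measure lborel {- a..a}) = ennreal (integral {- a..a} g / (2 * a))"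
proof -
  have meas: "g \<in> borel_measurable borel"
    by (intro borel_measurable_continuous_onI g)
  have int: "g integrable_on {- a..a}"
    by (intro integrable_continuous_real continuous_on_subset[OF g(1)]) auto
  have "(\<integral>\<^sup>+x. ennreal (g x) \<partial>uniform_measure lborel {- a..a})
      = ennreal (integral {- a..a} g) / emeasure lborel {- a..a}"
    using meas nn_integral_has_integral_lebesgue'[OF _ integrable_integral[OF int]] g
    by (subst nn_integral_uniform_measure) auto
  also have "\<dots> = ennreal (integral {- a..a} g / (2 * a))"
    using a integral_nonneg[OF int] g by (simp add: divide_ennreal)
  finally show ?thesis .
qed

text \<open>A continuous function has a finite integral over a compact interval, so the infinite
  branch of \<open>Lp_norm\<close> does not occur and the norm is the power of a real integral
  mean.\<close>

lemma Lp_norm_uniform_Icc: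
  assumes "continuous_on UNIV g" "\<And>x. 0 < g x" "0 < a"
  shows "Lp_norm p (uniform_measure lborel {- a..a}) g
    = ennreal ((integral {- a..a} (\<lambda>x. g x powr p) / (2 * a)) powr (1 / p))"
proof -
  have c: "continuous_on UNIV (\<lambda>x. g x powr p)"
    using assms by (intro continuous_on_powr continuous_intros) (auto simp: less_imp_neq[symmetric])
  have "0 \<le> integral {- a..a} (\<lambda>x. g x powr p)"
    by (intro integral_nonneg integrable_continuous_real continuous_on_subset[OF c]) auto
  moreover have "\<bar>g x\<bar> = g x" for x using assms(2)[of x] by simp
  ultimately show ?thesis
    using nn_integral_uniform_Icc[OF c _ assms(3)] assms(3) by (simp add: Lp_norm_def)
qed

theorem corollary4p9:
  fixes a r :: real and f :: "real \<Rightarrow> real"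
  assumes "a > 0"
    and "0 < r" and "r \<le> 1"
    and "log_subharmonic f"
  shows "Lp_norm (1 / r\<^sup>2) (uniform_measure lborel {-a..a}) (\<lambda>x. f (r * x))
           \<le> Lp_norm 1 (uniform_measure lborel {-a..a}) f"
proof -
  let ?I = "integral {- a..a} f / (2 * a)"
  let ?J = "integral {- a..a} (\<lambda>x. f (r * x) powr (1 / r\<^sup>2)) / (2 * a)"
  have f: "log_convex f" by (rule log_subharmonic_imp_log_convex) fact
  note cont = log_convex_continuous[OF f] and pos = log_convex_pos[OF f]
  have contr: "continuous_on UNIV (\<lambda>x. f (r * x))"
    by (intro continuous_on_compose2[OF cont] continuous_intros) auto
  have cont_powr: "continuous_on UNIV (\<lambda>x. f (r * x) powr (1 / r\<^sup>2))"
    using pos by (intro continuous_on_powr contr continuous_intros) (auto simp: less_imp_neq[symmetric])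
  have I: "0 \<le> ?I"
    using pos \<open>a > 0\<close>
    by (intro divide_nonneg_pos integral_nonneg integrable_continuous_real
        continuous_on_subset[OF cont]) (auto intro: less_imp_le)
  have J: "0 \<le> ?J"
    using \<open>a > 0\<close>
    by (intro divide_nonneg_pos integral_nonneg integrable_continuous_real
        continuous_on_subset[OF cont_powr]) auto
  \<comment> \<open>The outer exponent of the norm is the reciprocal of
    \<open>1 / r\<^sup>2\<close>, that is \<open>r\<^sup>2\<close>; raising the mean inequality to
    it cancels the power of \<open>?I\<close>.\<close>
  have "?J powr r\<^sup>2 \<le> (?I powr (1 / r\<^sup>2)) powr r\<^sup>2"
    using integral_mean_contraction[OF f assms(2,3,1)] J by (intro powr_mono2) auto
  also have "\<dots> = ?I"
    using powr_one[OF I] \<open>0 < r\<close> by (simp add: powr_powr)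
  finally have "?J powr r\<^sup>2 \<le> ?I" .
  moreover have "Lp_norm 1 (uniform_measure lborel {-a..a}) f = ennreal ?I"
    using Lp_norm_uniform_Icc[OF cont pos \<open>a > 0\<close>, of 1] powr_one[OF I] pos by (simp add: less_imp_le)
  moreover have "Lp_norm (1 / r\<^sup>2) (uniform_measure lborel {-a..a}) (\<lambda>x. f (r * x)) = ennreal (?J powr r\<^sup>2)"
    using Lp_norm_uniform_Icc[OF contr pos \<open>a > 0\<close>, of "1 / r\<^sup>2"] by simp
  ultimately show ?thesis by (simp add: ennreal_leI)
qed

end
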